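(* Let $S^1=\mathbb R/2\pi\mathbb Z$. Let $\Phi:S^1\to\mathbb R$ be a $C^3$ function with two nondegenerate critical points $c^{(1)}$ and $c^{(2)}$ (these being its only critical points), and assume $\Phi(c^{(1)})\neq\Phi(c^{(2)})$. Fix $\zeta\in S^1$ and for $a\in S^1$, $L\in\mathbb R^+$ define $f_{a,L}:S^1\to S^1$ by $f_{a,L}(\theta)=\zeta+L\Phi(\theta)+a$. Then there exists $L_0>0$ such that if $L\geq L_0$, there exist $L^*\in[L,\,L+2\pi/|\Phi(c^{(2)})-\Phi(c^{(1)})|]$ and $a^*\in[0,2\pi)$ such that $f_{a^*,L^*}$ is a Misiurewicz map, i.e. $f_{a^*,L^*}\in\mathscr M$ (equivalently, $(a^*,L^* )$ is a Misiurewicz pair).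
   Context: Misiurewicz maps. Let $f\in C^2(S^1,S^1)$ have critical set $C$. We say that $f$ is a Misiurewicz map, $f\in\mathscr M$, if the following hold for some neighborhood $V$ of $C$. (A) (Outside of $V$) There exist $\lambda_0>0$, $M_0\in\mathbb Z^+$ and $0<d_0\leq1$ such that (1) for all $n\geq M_0$, if $f^k(x)\notin V$ for $0\leq k\leq n-1$, then $|(f^n)'(x)|\geq e^{\lambda_0n}$; (2) for any $n\in\mathbb Z^+$, if $f^k(x)\notin V$ for $0\leq k\leq n-1$ and $f^n(x)\in V$, then $|(f^n)'(x)|\geq d_0e^{\lambda_0n}$. (B) (Critical orbits) For all $c\in C$ and $n>0$, $f^n(c)\notin V$. (C) (Inside $V$) (1) $f''(x)\neq0$ for all $x\in V$; (2) for all $x\in V\setminus C$ there exists an integer $p_0(x)>0$ such that $f^j(x)\notin V$ for all $1\leq j<p_0(x)$ and $|(f^{p_0(x)})'(x)|\geq d_0^{-1}e^{\frac13\lambda_0p_0(x)}$. A pair $(a,L)$ is called a Misiurewicz pair if $f_{a,L}\in\mathscr M$. *)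

theory Defs
  imports "HOL-Analysis.Analysis"
begin
definition circle_rel :: "real \<Rightarrow> real \<Rightarrow> bool" where
  "circle_rel x y \<longleftrightarrow> (\<exists>k::int. x - y = 2 * pi * of_int k)"

lemma circle_rel_refl: "circle_rel x x"
  unfolding circle_rel_def by (rule exI[of _ 0]) simp

lemma circle_rel_sym: "circle_rel x y \<Longrightarrow> circle_rel y x"
  unfolding circle_rel_def
proof (elim exE)
  fix k :: int assume "x - y = 2 * pi * of_int k"
  then have "y - x = 2 * pi * of_int (- k)" by simp
  then show "\<exists>k::int. y - x = 2 * pi * of_int k" by blast
qed

lemma circle_rel_add:
  assumes "circle_rel x y" "circle_rel u v"
  shows "circle_rel (x + u) (y + v)"
proof -
  obtain k l :: int where "x - y = 2 * pi * of_int k" "u - v = 2 * pi * of_int l"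
    using assms unfolding circle_rel_def by blast
  then have "(x + u) - (y + v) = 2 * pi * of_int (k + l)"
    by (simp add: algebra_simps)
  then show ?thesis unfolding circle_rel_def by blast
qed

lemma circle_rel_trans: "circle_rel x y \<Longrightarrow> circle_rel y z \<Longrightarrow> circle_rel x z"
  using circle_rel_add[of x y y z] unfolding circle_rel_def by simp

lemma circle_rel_minus:
  assumes "circle_rel x y" shows "circle_rel (- x) (- y)"
  using circle_rel_sym[OF assms] unfolding circle_rel_def by simp

quotient_type circle = real / circle_rel
  by (rule equivpI) (auto intro!: reflpI sympI transpI
        intro: circle_rel_refl circle_rel_sym circle_rel_trans)

lift_definition circle_of :: "real \<Rightarrow> circle" is "\<lambda>x. x" .

instantiation circle :: ab_group_add
begin

lift_definition zero_circle :: circle is 0 .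

lift_definition plus_circle :: "circle \<Rightarrow> circle \<Rightarrow> circle" is "(+)"
  by (rule circle_rel_add)

lift_definition uminus_circle :: "circle \<Rightarrow> circle" is "uminus"
  by (rule circle_rel_minus)

definition minus_circle :: "circle \<Rightarrow> circle \<Rightarrow> circle" where
  "minus_circle x y = x + - y"

instance
proof
  fix a b c :: circle
  show "a + b + c = a + (b + c)"
    by transfer (simp add: circle_rel_refl add.assoc)
  show "a + b = b + a"
    by transfer (simp add: circle_rel_refl add.commute)
  show "0 + a = a"
    by transfer (simp add: circle_rel_refl)
  show "- a + a = 0"
    by transfer (simp add: circle_rel_refl)
  show "a - b = a + - b"
    by (rule minus_circle_def)
qed

end

instantiation circle :: topological_space
begin

definition open_circle :: "circle set \<Rightarrow> bool" where
  "open_circle U \<longleftrightarrow> open (circle_of -` U)"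

instance
proof
  show "open (UNIV :: circle set)"
    by (simp add: open_circle_def)
  fix S T :: "circle set" and K :: "circle set set"
  show "open S \<Longrightarrow> open T \<Longrightarrow> open (S \<inter> T)"
    by (simp add: open_circle_def open_Int)
  show "\<forall>S\<in>K. open S \<Longrightarrow> open (\<Union>K)"
    by (auto simp: open_circle_def vimage_Union)
qed

end

lemma circle_of_eq_iff:
  "circle_of x = circle_of y \<longleftrightarrow> (\<exists>k::int. x - y = 2 * pi * of_int k)"
  by transfer (simp add: circle_rel_def)

lemma circle_of_surj: "\<exists>t. p = circle_of t"
  by transfer (auto intro: circle_rel_refl)

lemma circle_of_add: "circle_of (x + y) = circle_of x + circle_of y"
  by transfer (rule circle_rel_refl)

text \<open>Real-valued functions are differentiated along the covering map \<^const>\<open>circle_of\<close>.\<close>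

definition has_circle_deriv_real :: "(circle \<Rightarrow> real) \<Rightarrow> real \<Rightarrow> circle \<Rightarrow> bool" where
  "has_circle_deriv_real g D p \<longleftrightarrow>
     (\<exists>t. p = circle_of t \<and> ((\<lambda>s. g (circle_of s)) has_real_derivative D) (at t))"

definition circle_deriv_real :: "(circle \<Rightarrow> real) \<Rightarrow> circle \<Rightarrow> real" where
  "circle_deriv_real g p = (THE D. has_circle_deriv_real g D p)"

primrec circle_Ck_real :: "nat \<Rightarrow> (circle \<Rightarrow> real) \<Rightarrow> bool" where
  "circle_Ck_real 0 g \<longleftrightarrow> continuous_on UNIV g"
| "circle_Ck_real (Suc k) g \<longleftrightarrow>
     (\<forall>p. \<exists>D. has_circle_deriv_real g D p) \<and> circle_Ck_real k (circle_deriv_real g)"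

text \<open>For circle maps a local lift to the real line is differentiated. Two local lifts that are
  continuous at the point differ by a constant nearby, so the derivative is unique.\<close>

definition has_circle_deriv :: "(circle \<Rightarrow> circle) \<Rightarrow> real \<Rightarrow> circle \<Rightarrow> bool" where
  "has_circle_deriv f D p \<longleftrightarrow>
     (\<exists>F t. p = circle_of t \<and>
        (\<forall>\<^sub>F s in nhds t. f (circle_of s) = circle_of (F s)) \<and>
        (F has_real_derivative D) (at t))"

definition circle_deriv :: "(circle \<Rightarrow> circle) \<Rightarrow> circle \<Rightarrow> real" where
  "circle_deriv f p = (THE D. has_circle_deriv f D p)"

definition circle_C2 :: "(circle \<Rightarrow> circle) \<Rightarrow> bool" where
  "circle_C2 f \<longleftrightarrow>
     (\<forall>p. \<exists>D. has_circle_deriv f D p) \<and> circle_Ck_real 1 (circle_deriv f)"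

lemma has_real_derivative_shift_period:
  fixes h :: "real \<Rightarrow> real"
  assumes "(h has_real_derivative D) (at (t + c))"
  shows "((\<lambda>s. h (s + c)) has_real_derivative D) (at t)"
  using assms DERIV_shift by blast

lemma has_circle_deriv_real_unique:
  assumes "has_circle_deriv_real g D p" "has_circle_deriv_real g E p"
  shows "D = E"
proof -
  let ?h = "\<lambda>s. g (circle_of s)"
  obtain t u where t: "p = circle_of t" "(?h has_real_derivative D) (at t)"
    and u: "p = circle_of u" "(?h has_real_derivative E) (at u)"
    using assms unfolding has_circle_deriv_real_def by blast
  then obtain k :: int where "u - t = 2 * pi * of_int k"
    using circle_of_eq_iff by metis
  then have k: "u = t + 2 * pi * of_int k" by simp
  have "?h (s + 2 * pi * of_int k) = ?h s" for s
    by (rule arg_cong[where f = g]) (auto simp: circle_of_eq_iff)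
  then have "(?h has_real_derivative E) (at t)"
    using has_real_derivative_shift_period[OF u(2)[unfolded k]] by simp
  with t(2) show ?thesis by (rule DERIV_unique)
qed

lemma circle_deriv_real_eq:
  "has_circle_deriv_real g D p \<Longrightarrow> circle_deriv_real g p = D"
  unfolding circle_deriv_real_def using has_circle_deriv_real_unique by blast

lemma has_circle_deriv_unique:
  assumes "has_circle_deriv f D p" "has_circle_deriv f E p"
  shows "D = E"
proof -
  obtain F t where F: "p = circle_of t"
      "\<forall>\<^sub>F s in nhds t. f (circle_of s) = circle_of (F s)" "(F has_real_derivative D) (at t)"
    using assms(1) unfolding has_circle_deriv_def by blast
  obtain G0 u where G0: "p = circle_of u"
      "\<forall>\<^sub>F s in nhds u. f (circle_of s) = circle_of (G0 s)" "(G0 has_real_derivative E) (at u)"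
    using assms(2) unfolding has_circle_deriv_def by blast
  obtain k :: int where "u - t = 2 * pi * of_int k"
    using F(1) G0(1) circle_of_eq_iff by metis
  then have k: "u = t + 2 * pi * of_int k" by simp
  define c where "c = 2 * pi * of_int k"
  define G where "G s = G0 (s + c)" for s
  have per: "circle_of (s + c) = circle_of s" for s
    by (auto simp: circle_of_eq_iff c_def)
  have G: "(G has_real_derivative E) (at t)"
    unfolding G_def using has_real_derivative_shift_period G0(3) k c_def by blast
  have "filterlim (\<lambda>s. s + c) (nhds u) (nhds t)"
    unfolding k c_def by (intro tendsto_add tendsto_const filterlim_ident)
  then have "\<forall>\<^sub>F s in nhds t. f (circle_of (s + c)) = circle_of (G0 (s + c))"
    using G0(2) by (rule eventually_compose_filterlim[rotated])
  then have Glift: "\<forall>\<^sub>F s in nhds t. f (circle_of s) = circle_of (G s)"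
    by (simp add: per G_def)
  define H where "H s = F s - G s" for s
  have H: "(H has_real_derivative D - E) (at t)"
    unfolding H_def by (intro DERIV_diff F(3) G)
  then have "isCont H t" by (rule DERIV_isCont)
  then have "(H \<longlongrightarrow> H t) (nhds t)"
    by (simp add: continuous_at_imp_continuous_at_within isCont_def tendsto_at_iff_tendsto_nhds)
  then have near: "\<forall>\<^sub>F s in nhds t. dist (H s) (H t) < 2 * pi"
    by (rule tendstoD) simp
  have H_int: "\<exists>m::int. H s = 2 * pi * of_int m" if "f (circle_of s) = circle_of (F s)"
      "f (circle_of s) = circle_of (G s)" for s
    using that circle_of_eq_iff[of "F s" "G s"] by (simp add: H_def)
  have "f (circle_of t) = circle_of (F t)" "f (circle_of t) = circle_of (G t)"
    using F(2) Glift by (auto dest: eventually_nhds_x_imp_x)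
  then obtain m0 :: int where m0: "H t = 2 * pi * of_int m0" using H_int by blast
  have "\<forall>\<^sub>F s in nhds t. H s = H t"
    using near F(2) Glift
  proof eventually_elim
    case (elim s)
    then obtain m :: int where m: "H s = 2 * pi * of_int m" using H_int by blast
    have "H s - H t = 2 * pi * of_int (m - m0)" by (simp add: m m0 algebra_simps)
    then have "2 * pi * \<bar>of_int (m - m0) :: real\<bar> < 2 * pi * 1"
      using elim(1) by (simp add: dist_real_def abs_mult)
    then have "\<bar>of_int (m - m0) :: real\<bar> < 1" 
      using mult_less_cancel_left_pos[of "2 * pi" "\<bar>of_int (m - m0)\<bar>" 1] by simp
    then have "m = m0" by linarith
    then show ?case by (simp add: m m0)
  qed
  then have "(H has_real_derivative 0) (at t)"
    using DERIV_cong_ev[of t t H "\<lambda>_. H t" 0 0] by simp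
  with H have "D - E = 0" by (rule DERIV_unique)
  then show ?thesis by simp
qed

lemma circle_deriv_eq: "has_circle_deriv f D p \<Longrightarrow> circle_deriv f p = D"
  unfolding circle_deriv_def using has_circle_deriv_unique by blast

definition circle_crit :: "(circle \<Rightarrow> circle) \<Rightarrow> circle set" where
  "circle_crit f = {x. circle_deriv f x = 0}"

text \<open>A neighborhood of a set need not itself be open; the constants in the expansion conditions
  outside and inside \<open>V\<close> are shared.\<close>

definition Misiurewicz :: "(circle \<Rightarrow> circle) set" where
  "Misiurewicz = {f. circle_C2 f \<and>
     (\<exists>V. circle_crit f \<subseteq> interior V \<and>
       (\<exists>(lam0::real) (M0::nat) (d0::real). 0 < lam0 \<and> 0 < M0 \<and> 0 < d0 \<and> d0 \<le> 1 \<and>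
         (\<forall>n\<ge>M0. \<forall>x. (\<forall>k<n. (f ^^ k) x \<notin> V) \<longrightarrow>
            \<bar>circle_deriv (f ^^ n) x\<bar> \<ge> exp (lam0 * real n)) \<and>
         (\<forall>n>0. \<forall>x. (\<forall>k<n. (f ^^ k) x \<notin> V) \<and> (f ^^ n) x \<in> V \<longrightarrow>
            \<bar>circle_deriv (f ^^ n) x\<bar> \<ge> d0 * exp (lam0 * real n)) \<and>
         (\<forall>c\<in>circle_crit f. \<forall>n>0. (f ^^ n) c \<notin> V) \<and>
         (\<forall>x\<in>V. circle_deriv_real (circle_deriv f) x \<noteq> 0) \<and>
         (\<forall>x\<in>V - circle_crit f. \<exists>p0>0.
            (\<forall>j. 1 \<le> j \<and> j < p0 \<longrightarrow> (f ^^ j) x \<notin> V) \<and>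
            \<bar>circle_deriv (f ^^ p0) x\<bar> \<ge> inverse d0 * exp (1/3 * lam0 * real p0))))}"

definition circle_family :: "circle \<Rightarrow> (circle \<Rightarrow> real) \<Rightarrow> circle \<Rightarrow> real \<Rightarrow> circle \<Rightarrow> circle" where
  "circle_family zeta Phi a L \<theta> = zeta + circle_of (L * Phi \<theta>) + a"

end

theory Submission
  imports Defs
begin

text \<open>
  Write \<open>\<phi>\<close> for the lift of \<open>Phi\<close> to the line, so that \<open>f = f\<^bsub>a,L\<^esub>\<close> has derivative \<open>L \<phi>'\<close>. The
  two parameters are used to make both critical points land on one repelling fixed point \<open>x\<^sub>0\<close> that
  stays at a definite distance from the critical set. If \<open>L (Phi c2 - Phi c1)\<close> is a multiple of
  \<open>2 \<pi>\<close>, then \<open>f c1 = f c2\<close> whatever \<open>a\<close> is; consecutive such \<open>L\<close> are exactly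
  \<open>2 \<pi> / \<bar>Phi c2 - Phi c1\<bar>\<close> apart. If in addition \<open>L (\<phi> x\<^sub>0 - Phi c1)\<close> is a multiple of \<open>2 \<pi>\<close>,
  then the choice of \<open>a\<close> with \<open>f c1 = x\<^sub>0\<close> also gives \<open>f x\<^sub>0 = x\<^sub>0\<close>. As \<open>L\<close> grows, the numbers
  \<open>L \<phi> x\<close> sweep out more than a full turn while \<open>x\<close> runs through a fixed interval on which \<open>\<phi>'\<close> does
  not vanish, and so such an \<open>x\<^sub>0\<close> exists in that interval.

  The neighbourhood is \<open>V = {\<bar>\<phi>'\<bar> < \<eta>}\<close> with \<open>\<eta>\<close> independent of \<open>L\<close>. Outside \<open>V\<close> the derivative
  of \<open>f\<close> is at least \<open>L \<eta>\<close>, which exceeds \<open>e\<close> for large \<open>L\<close>; this gives (A) with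
  \<open>\<lambda>\<^sub>0 = M\<^sub>0 = d\<^sub>0 = 1\<close>. Condition (B) holds since \<open>x\<^sub>0\<close> is fixed and lies outside \<open>V\<close>.
  Nondegeneracy of the critical points makes \<open>\<bar>\<phi>'\<bar> + \<bar>\<phi>''\<bar>\<close> bounded below, and then \<open>\<phi>'' \<noteq> 0\<close> on
  \<open>V\<close> if \<open>\<eta>\<close> is small.

  The remaining point is the recovery condition (C)(2), in \<open>recovery_time\<close>. Let \<open>x \<in> V\<close> and
  \<open>h = \<bar>\<phi>' x\<bar>\<close>. A critical point lies within \<open>O(h)\<close> of \<open>x\<close> (\<open>zero_near_small_value\<close>), hence \<open>f x\<close>
  is within \<open>K L h\<^sup>2\<close> of \<open>x\<^sub>0\<close>. Follow the orbit of \<open>f x\<close> while it is \<open>\<delta>\<close>-close to \<open>x\<^sub>0\<close>,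
  say for \<open>q\<close> steps. The derivative \<open>T\<close> accumulated from \<open>x\<close> is at least \<open>L h (L \<eta>)\<^sup>q\<close>. Distances to
  \<open>x\<^sub>0\<close> grow at most by the factor \<open>L M\<close>, where \<open>M = sup \<bar>\<phi>'\<bar>\<close>, and therefore
  \<open>\<delta> \<le> (L M)\<^sup>q K L h\<^sup>2\<close>. Eliminating \<open>h\<close> gives \<open>T\<^sup>2 \<ge> (L \<delta> / K) (L \<eta>\<^sup>2 / M)\<^sup>q\<close>, and for large \<open>L\<close>
  both factors \<open>L \<delta> / K\<close> and \<open>L \<eta>\<^sup>2 / M\<close> exceed \<open>e\<close>. The argument can be
  as crude as this because the ratio \<open>M / \<eta>\<close> of the largest to the smallest expansion, which is
  lost at every step, does not depend on \<open>L\<close>, while the gain per step is proportional to \<open>L\<close>.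
\<close>

section \<open>Calculus on the circle through the covering map\<close>

lemma has_circle_deriv_real_circle_of_iff:
  "has_circle_deriv_real g D (circle_of t) \<longleftrightarrow>
     ((\<lambda>s. g (circle_of s)) has_real_derivative D) (at t)"
proof
  assume "has_circle_deriv_real g D (circle_of t)"
  then obtain u where u: "circle_of t = circle_of u"
      "((\<lambda>s. g (circle_of s)) has_real_derivative D) (at u)"
    unfolding has_circle_deriv_real_def by blast
  obtain k :: int where "u - t = 2 * pi * of_int k"
    using u(1) circle_of_eq_iff by metis
  then have k: "u = t + 2 * pi * of_int k" by simp
  have "circle_of (s + 2 * pi * of_int k) = circle_of s" for s
    by (auto simp: circle_of_eq_iff)
  then show "((\<lambda>s. g (circle_of s)) has_real_derivative D) (at t)"
    using has_real_derivative_shift_period[OF u(2)[unfolded k]] by simp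
next
  assume "((\<lambda>s. g (circle_of s)) has_real_derivative D) (at t)"
  then show "has_circle_deriv_real g D (circle_of t)"
    unfolding has_circle_deriv_real_def by blast
qed

lemma DERIV_circle_of:
  assumes "\<forall>p. \<exists>D. has_circle_deriv_real g D p"
  shows "((\<lambda>s. g (circle_of s)) has_real_derivative circle_deriv_real g (circle_of t)) (at t)"
  using assms circle_deriv_real_eq has_circle_deriv_real_circle_of_iff by metis

lemma continuous_on_circle_of: "continuous_on S circle_of"
proof -
  have "continuous_on UNIV circle_of"
    by (simp add: continuous_on_open_vimage open_circle_def)
  then show ?thesis using continuous_on_subset by blast
qed

lemma continuous_on_circle_iff:
  fixes g :: "circle \<Rightarrow> 'a::topological_space"
  shows "continuous_on UNIV g \<longleftrightarrow> continuous_on UNIV (\<lambda>t. g (circle_of t))"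
  by (simp add: continuous_on_open_vimage open_circle_def vimage_def)

lemma circle_Ck_real_Suc_imp: "circle_Ck_real (Suc k) g \<Longrightarrow> circle_Ck_real k g"
proof (induction k arbitrary: g)
  case 0
  then have "\<forall>p. \<exists>D. has_circle_deriv_real g D p" by simp
  from DERIV_circle_of[OF this] have "continuous_on UNIV (\<lambda>t. g (circle_of t))"
    by (intro continuous_at_imp_continuous_on ballI DERIV_isCont)
  then show ?case by (simp add: continuous_on_circle_iff)
next
  case (Suc k)
  from Suc.prems have "\<forall>p. \<exists>D. has_circle_deriv_real g D p"
    and "circle_Ck_real (Suc k) (circle_deriv_real g)" by simp_all
  with Suc.IH show ?case by simp
qed

lemma circle_of_representative: "\<exists>t\<in>{0..<2*pi}. p = circle_of t"
proof -
  obtain s where s: "p = circle_of s" using circle_of_surj by blast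
  define k where "k = \<lfloor>s / (2*pi)\<rfloor>"
  have "of_int k \<le> s / (2*pi)" "s / (2*pi) < of_int k + 1" unfolding k_def by linarith+
  then have "s - 2*pi * of_int k \<in> {0..<2*pi}" by (simp add: field_simps)
  moreover have "p = circle_of (s - 2*pi * of_int k)" by (auto simp: s circle_of_eq_iff)
  ultimately show ?thesis by blast
qed

lemma compact_circle: "compact (UNIV :: circle set)"
proof -
  have "compact (circle_of ` {0..2*pi})"
    by (intro compact_continuous_image continuous_on_circle_of compact_Icc)
  moreover have "circle_of ` {0..2*pi} = UNIV"
  proof (intro UNIV_eq_I[symmetric])
    fix p
    obtain t where "t \<in> {0..<2*pi}" "p = circle_of t" using circle_of_representative by blast
    then show "p \<in> circle_of ` {0..2*pi}" by auto
  qed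
  ultimately show ?thesis by simp
qed

lemma funpow_lift:
  assumes "\<And>t. f (circle_of t) = circle_of (F t)"
  shows "(f ^^ n) (circle_of t) = circle_of ((F ^^ n) t)"
  by (induction n) (simp_all add: assms)

lemma DERIV_funpow:
  fixes F :: "real \<Rightarrow> real"
  assumes "\<And>t. (F has_real_derivative F' t) (at t)"
  shows "((F ^^ n) has_real_derivative (\<Prod>k<n. F' ((F ^^ k) t))) (at t)"
proof (induction n)
  case 0
  show ?case by (simp add: id_def)
next
  case (Suc n)
  from DERIV_chain[OF assms Suc] show ?case by (simp add: o_def mult.commute)
qed

lemma has_circle_deriv_lift:
  assumes "\<And>t. f (circle_of t) = circle_of (F t)" "(F has_real_derivative D) (at t)"
  shows "has_circle_deriv f D (circle_of t)"
  unfolding has_circle_deriv_def using assms by (intro exI[of _ F] exI[of _ t]) auto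

lemma circle_deriv_funpow:
  assumes lift: "\<And>t. f (circle_of t) = circle_of (F t)"
    and F': "\<And>t. (F has_real_derivative F' t) (at t)"
  shows "circle_deriv (f ^^ n) p = (\<Prod>k<n. circle_deriv f ((f ^^ k) p))"
proof -
  obtain t where t: "p = circle_of t" using circle_of_surj by blast
  have f': "circle_deriv f (circle_of u) = F' u" for u
    by (intro circle_deriv_eq has_circle_deriv_lift[of f, OF lift F'])
  have "has_circle_deriv (f ^^ n) (\<Prod>k<n. F' ((F ^^ k) t)) (circle_of t)"
    by (rule has_circle_deriv_lift[OF _ DERIV_funpow[OF F']]) (rule funpow_lift[of f, OF lift])
  then show ?thesis
    by (simp add: circle_deriv_eq t funpow_lift[of f, OF lift] f')
qed

section \<open>Critical points near points of small derivative\<close>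

text \<open>The zero is found by moving in the direction in which \<open>g\<close> decreases: as long as
  \<open>0 < g < \<mu>/2\<close> the slope cannot rise above \<open>-\<mu>/2\<close>, for \<open>\<bar>g\<bar> + \<bar>g'\<bar>\<close>
  would be below \<open>\<mu>\<close> where it equals \<open>-\<mu>/2\<close>.\<close>

lemma zero_near_small_value_decreasing:
  fixes g :: "real \<Rightarrow> real"
  assumes der: "\<And>t. (g has_real_derivative g' t) (at t)"
    and low: "\<And>t. \<mu> \<le> \<bar>g t\<bar> + \<bar>g' t\<bar>"
    and small: "0 < g x" "g x < \<mu> / 2" and dec: "g' x < 0"
  shows "\<exists>c\<in>{x..x + 2 * g x / \<mu>}. g c = 0"
proof (rule ccontr)
  assume none: "\<not> ?thesis"
  have mu: "0 < \<mu>" using small by simp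
  define R where "R = 2 * g x / \<mu>"
  have R: "0 < R" "\<mu> / 2 * R = g x" using small mu by (simp_all add: R_def)
  have cont: "continuous_on {x..b} g" for b
    by (intro continuous_at_imp_continuous_on ballI DERIV_isCont[OF der])
  have pos: "0 < g t" if "t \<in> {x..x+R}" for t
  proof (rule ccontr)
    assume "\<not> 0 < g t"
    then have "g t \<le> 0" by simp
    with small that cont obtain c where "x \<le> c" "c \<le> t" "g c = 0"
      using IVT2'[of g t 0 x] by auto
    then show False using none that unfolding R_def by auto
  qed
  \<comment> \<open>If \<open>g\<close> had no zero, it would lie above the line of slope \<open>-\<mu>/2\<close> again at \<open>x + R\<close>, and so its
    distance to this line would have an interior minimum.\<close>
  define \<psi> where "\<psi> t = g t + \<mu> / 2 * (t - x)" for t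
  have psi': "(\<psi> has_real_derivative g' t + \<mu> / 2) (at t)" for t
    unfolding \<psi>_def by (auto intro!: derivative_eq_intros der)
  have "continuous_on {x..x+R} \<psi>"
    by (intro continuous_at_imp_continuous_on ballI DERIV_isCont[OF psi'])
  then obtain u where u: "u \<in> {x..x+R}" "\<And>t. t \<in> {x..x+R} \<Longrightarrow> \<psi> u \<le> \<psi> t"
    using continuous_attains_inf[of "{x..x+R}" \<psi>] R(1) by auto
  have "g' x + \<mu> / 2 < 0" using low[of x] small dec by linarith
  from DERIV_neg_dec_right[OF psi' this]
  obtain e where e: "0 < e" "\<And>h. 0 < h \<Longrightarrow> h < e \<Longrightarrow> \<psi> (x + h) < \<psi> x" by blast
  define h where "h = min (e/2) R"
  have "\<psi> (x + h) < \<psi> x" by (rule e(2)) (use e(1) R(1) in \<open>auto simp: h_def\<close>)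
  moreover have "\<psi> u \<le> \<psi> (x + h)" by (rule u(2)) (use e(1) R(1) in \<open>auto simp: h_def\<close>)
  ultimately have below: "\<psi> u < g x" by (simp add: \<psi>_def)
  have "u \<noteq> x" using below by (auto simp: \<psi>_def)
  moreover have "u \<noteq> x + R" using below pos[of "x+R"] R by (auto simp: \<psi>_def)
  ultimately have in_u: "x < u" "u < x + R" using u(1) by auto
  have "g' u + \<mu> / 2 = 0"
  proof (rule DERIV_local_min[OF psi'])
    show "0 < min (u - x) (x + R - u)" using in_u by simp
    show "\<forall>y. \<bar>u - y\<bar> < min (u - x) (x + R - u) \<longrightarrow> \<psi> u \<le> \<psi> y"
      by (intro allI impI u(2)) (simp add: abs_less_iff)
  qed
  then have "\<mu> / 2 \<le> g u" using low[of u] pos[OF u(1)] mu by linarith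
  moreover have "0 \<le> \<mu> / 2 * (u - x)" using mu in_u by simp
  ultimately show False using below small by (simp add: \<psi>_def)
qed

text \<open>The other sign patterns reduce to the decreasing positive one by reflecting the argument
  or the value.\<close>

lemma zero_near_small_value:
  fixes g :: "real \<Rightarrow> real"
  assumes der: "\<And>t. (g has_real_derivative g' t) (at t)"
    and low: "\<And>t. \<mu> \<le> \<bar>g t\<bar> + \<bar>g' t\<bar>"
    and small: "\<bar>g x\<bar> < \<mu> / 2"
  shows "\<exists>c. g c = 0 \<and> \<bar>x - c\<bar> \<le> 2 * \<bar>g x\<bar> / \<mu>"
proof -
  have mirror: "((\<lambda>s. g (- s)) has_real_derivative - g' (- t)) (at t)" for t
    using der[of "- t"] by (simp add: DERIV_mirror)
  have neg: "((\<lambda>s. - g s) has_real_derivative - g' t) (at t)" for t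
    by (auto intro!: derivative_eq_intros der)
  have negmirror: "((\<lambda>s. - g (- s)) has_real_derivative g' (- t)) (at t)" for t
    using DERIV_minus[OF mirror] by simp
  have "g' x \<noteq> 0" using low[of x] small by auto
  then consider "g x = 0" | "0 < g x" "g' x < 0" | "0 < g x" "0 < g' x"
    | "g x < 0" "0 < g' x" | "g x < 0" "g' x < 0" by linarith
  then show ?thesis
  proof cases
    case 1
    then show ?thesis by (intro exI[of _ x]) simp
  next
    case 2
    then obtain c where "c \<in> {x..x + 2 * g x / \<mu>}" "g c = 0"
      using zero_near_small_value_decreasing[OF der low, of x] small by auto
    with 2 show ?thesis by (intro exI[of _ c]) auto
  next
    case 3
    then obtain c where "c \<in> {-x..-x + 2 * g x / \<mu>}" "g (-c) = 0"
      using zero_near_small_value_decreasing[OF mirror, of \<mu> "-x"] low small by auto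
    with 3 show ?thesis by (intro exI[of _ "-c"]) auto
  next
    case 4
    then obtain c where "c \<in> {x..x + 2 * (- g x) / \<mu>}" "g c = 0"
      using zero_near_small_value_decreasing[OF neg, of \<mu> x] low small by auto
    with 4 show ?thesis by (intro exI[of _ c]) auto
  next
    case 5
    then obtain c where "c \<in> {-x..-x + 2 * (- g x) / \<mu>}" "g (-c) = 0"
      using zero_near_small_value_decreasing[OF negmirror, of \<mu> "-x"] low small by auto
    with 5 show ?thesis by (intro exI[of _ "-c"]) auto
  qed
qed

lemma DERIV_bounded_imp_Lipschitz:
  fixes g :: "real \<Rightarrow> real"
  assumes "\<And>t. (g has_real_derivative g' t) (at t)" "\<And>t. t \<in> closed_segment x y \<Longrightarrow> \<bar>g' t\<bar> \<le> B"
  shows "\<bar>g x - g y\<bar> \<le> B * \<bar>x - y\<bar>"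
  using field_differentiable_bound[of "closed_segment x y" g g' B x y] assms
  by (auto intro: has_field_derivative_at_within)

lemma critical_point_near_small_derivative:
  fixes \<phi> :: "real \<Rightarrow> real"
  assumes d1: "\<And>t. (\<phi> has_real_derivative \<phi>' t) (at t)"
    and d2: "\<And>t. (\<phi>' has_real_derivative \<phi>'' t) (at t)"
    and low: "\<And>t. \<mu> \<le> \<bar>\<phi>' t\<bar> + \<bar>\<phi>'' t\<bar>"
    and up: "\<And>t. \<bar>\<phi>'' t\<bar> \<le> B"
    and small: "\<bar>\<phi>' x\<bar> < \<mu> / 2"
  shows "\<exists>c. \<phi>' c = 0 \<and> \<bar>\<phi> x - \<phi> c\<bar> \<le> 4 * B / \<mu>\<^sup>2 * (\<phi>' x)\<^sup>2"
proof -
  obtain c where c: "\<phi>' c = 0" "\<bar>x - c\<bar> \<le> 2 * \<bar>\<phi>' x\<bar> / \<mu>"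
    using zero_near_small_value[OF d2 low small] by blast
  have B: "0 \<le> B" using up[of x] by linarith
  have "\<bar>\<phi>' t\<bar> \<le> B * \<bar>x - c\<bar>" if "t \<in> closed_segment x c" for t
  proof -
    have "\<bar>\<phi>' t - \<phi>' c\<bar> \<le> B * \<bar>t - c\<bar>" by (rule DERIV_bounded_imp_Lipschitz[OF d2 up])
    also have "\<dots> \<le> B * \<bar>x - c\<bar>"
      using that B by (intro mult_left_mono) (auto simp: closed_segment_eq_real_ivl split: if_splits)
    finally show ?thesis by (simp add: c)
  qed
  then have "\<bar>\<phi> x - \<phi> c\<bar> \<le> B * \<bar>x - c\<bar> * \<bar>x - c\<bar>"
    by (rule DERIV_bounded_imp_Lipschitz[OF d1])
  also have "\<dots> = B * \<bar>x - c\<bar>\<^sup>2" by (simp add: power2_eq_square)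
  also have "\<dots> \<le> B * (2 * \<bar>\<phi>' x\<bar> / \<mu>)\<^sup>2"
    using c(2) B by (intro mult_left_mono power_mono) auto
  also have "\<dots> = 4 * B / \<mu>\<^sup>2 * (\<phi>' x)\<^sup>2" by (simp add: power_divide power_mult_distrib)
  finally show ?thesis using c(1) by blast
qed

section \<open>Recovery of the derivative after a passage near the critical set\<close>

text \<open>The abstract form of the recovery estimate: \<open>y\<close> is an orbit that starts at distance at
  most \<open>K L h\<^sup>2\<close> from \<open>x\<^sub>0\<close>, and \<open>q\<close> is the time at which it leaves the \<open>\<delta>\<close>-ball. An orbit that never
  leaves the ball expands forever, and any late \<open>q\<close> will do.\<close>

lemma recovery_time:
  fixes y :: "nat \<Rightarrow> real"
  assumes pos: "0 < L" "0 < h" "0 < \<eta>" "0 < M" "0 < K"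
    and step: "\<And>j. \<bar>y (Suc j) - x0\<bar> \<le> L * M * \<bar>y j - x0\<bar>"
    and start: "\<bar>y 0 - x0\<bar> \<le> L * (K * h\<^sup>2)"
    and L1: "exp 1 \<le> L * \<eta>" and L2: "exp 1 * M \<le> L * \<eta>\<^sup>2" and L3: "exp 1 * K \<le> L * \<delta>"
  shows "\<exists>q. (\<forall>j<q. \<bar>y j - x0\<bar> \<le> \<delta>) \<and> exp (1/3 * real (Suc q)) \<le> L * h * (L * \<eta>) ^ q"
proof (cases "\<exists>q. \<delta> < \<bar>y q - x0\<bar>")
  case True
  define q where "q = (LEAST q. \<delta> < \<bar>y q - x0\<bar>)"
  have q: "\<delta> < \<bar>y q - x0\<bar>" unfolding q_def by (rule LeastI_ex[OF True])
  have near: "\<forall>j<q. \<bar>y j - x0\<bar> \<le> \<delta>" using not_less_Least unfolding q_def by force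
  have grow: "\<bar>y j - x0\<bar> \<le> (L * M) ^ j * (L * (K * h\<^sup>2))" for j
  proof (induction j)
    case 0
    then show ?case using start by simp
  next
    case (Suc j)
    have "L * M * \<bar>y j - x0\<bar> \<le> L * M * ((L * M) ^ j * (L * (K * h\<^sup>2)))"
      using pos by (intro mult_left_mono[OF Suc]) auto
    with step[of j] have "\<bar>y (Suc j) - x0\<bar> \<le> L * M * ((L * M) ^ j * (L * (K * h\<^sup>2)))"
      by (rule order_trans)
    then show ?case by (simp add: mult.assoc)
  qed
  define T where "T = L * h * (L * \<eta>) ^ q"
  have T0: "0 \<le> T" using pos by (simp add: T_def)
  have c: "0 < K * (L * M) ^ q" using pos by simp
  have "exp 1 ^ Suc q * (K * (L * M) ^ q) = exp 1 * K * (L * (exp 1 * M)) ^ q"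
    by (simp add: power_mult_distrib algebra_simps)
  also have "\<dots> \<le> L * \<delta> * (L * (L * \<eta>\<^sup>2)) ^ q"
  proof (rule mult_mono[OF L3 power_mono])
    show "L * (exp 1 * M) \<le> L * (L * \<eta>\<^sup>2)" using L2 pos by (intro mult_left_mono) auto
    have "0 \<le> exp 1 * K" using pos by simp
    then show "0 \<le> L * \<delta>" using L3 by (rule order_trans)
  qed (use pos in auto)
  also have "\<dots> \<le> L * ((L * M) ^ q * (L * (K * h\<^sup>2))) * (L * (L * \<eta>\<^sup>2)) ^ q"
    using q grow[of q] pos by (intro mult_right_mono mult_left_mono) auto
  also have "\<dots> = T\<^sup>2 * (K * (L * M) ^ q)"
    by (simp add: T_def power_mult_distrib power2_eq_square mult_ac)
  finally have sq: "exp 1 ^ Suc q \<le> T\<^sup>2" using c by (simp only: mult_le_cancel_right_pos)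
  have "(exp (1/3 * real (Suc q)))\<^sup>2 = exp (2/3 * real (Suc q))"
    by (simp flip: exp_of_nat_mult)
  also have "\<dots> \<le> exp (real (Suc q) * 1)" by simp
  also have "\<dots> = exp 1 ^ Suc q" by (rule exp_of_nat_mult)
  finally have "(exp (1/3 * real (Suc q)))\<^sup>2 \<le> T\<^sup>2" using sq by linarith
  then have "exp (1/3 * real (Suc q)) \<le> T" using T0 by (rule power2_le_imp_le)
  then show ?thesis using near unfolding T_def by blast
next
  case False
  obtain q :: nat where q: "(1/3 - ln (L * h)) * (3/2) \<le> real q"
    using real_arch_simple by blast
  have "exp (1/3 * real (Suc q)) \<le> exp (ln (L * h) + real q * 1)"
    using q by (simp add: field_simps)
  also have "\<dots> = L * h * exp 1 ^ q"
    using pos by (simp only: exp_add exp_ln exp_of_nat_mult mult_pos_pos)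
  also have "\<dots> \<le> L * h * (L * \<eta>) ^ q"
    using L1 pos by (intro mult_left_mono power_mono) auto
  finally show ?thesis using False by (intro exI[of _ q]) (auto simp: not_less)
qed

section \<open>Maps whose critical values are a repelling fixed point\<close>

text \<open>The constants \<open>\<eta>\<close>, \<open>\<mu>\<close>, \<open>M\<close>, \<open>B\<close>, \<open>\<delta>\<close> will be chosen from \<open>Phi\<close> alone, and so the last
  three hypotheses say that \<open>L\<close> is large. The constant \<open>4 B / \<mu>\<^sup>2\<close> is the \<open>K\<close> for which \<open>Phi\<close> differs from
  a critical value by at most \<open>K Phi'\<^sup>2\<close> where \<open>Phi'\<close> is small.\<close>

lemma Misiurewicz_if_critical_values_fixed:
  fixes Phi :: "circle \<Rightarrow> real"
  defines "g \<equiv> circle_deriv_real Phi" and "g' \<equiv> circle_deriv_real (circle_deriv_real Phi)"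
  assumes C2: "circle_Ck_real 2 Phi"
    and f: "f = circle_family zeta Phi a L" and L: "0 < L"
    and crit: "\<And>p. g p = 0 \<Longrightarrow> f p = circle_of x0"
    and fixed: "f (circle_of x0) = circle_of x0"
    and away: "\<And>t. \<bar>t - x0\<bar> \<le> \<delta> \<Longrightarrow> \<eta> \<le> \<bar>g (circle_of t)\<bar>"
    and low: "\<And>p. \<mu> \<le> \<bar>g p\<bar> + \<bar>g' p\<bar>"
    and up: "\<And>p. \<bar>g p\<bar> \<le> M" "\<And>p. \<bar>g' p\<bar> \<le> B"
    and pos: "0 < \<eta>" "0 < M" "0 < B" "0 < \<delta>" "2 * \<eta> \<le> \<mu>"
    and large: "exp 1 \<le> L * \<eta>" "exp 1 * M \<le> L * \<eta>\<^sup>2" "exp 1 * (4 * B / \<mu>\<^sup>2) \<le> L * \<delta>"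
  shows "f \<in> Misiurewicz"
proof -
  define \<phi> where "\<phi> t = Phi (circle_of t)" for t
  from C2 have exD: "\<forall>p. \<exists>D. has_circle_deriv_real Phi D p"
    and exD2: "\<forall>p. \<exists>D. has_circle_deriv_real g D p" and contg': "continuous_on UNIV g'"
    and C1g: "circle_Ck_real (Suc 0) g"
    by (simp_all add: numeral_2_eq_2 g_def g'_def)
  have d1: "(\<phi> has_real_derivative g (circle_of t)) (at t)" for t
    unfolding \<phi>_def g_def by (rule DERIV_circle_of[OF exD])
  have d2: "((\<lambda>t. g (circle_of t)) has_real_derivative g' (circle_of t)) (at t)" for t
    using DERIV_circle_of[OF exD2] by (simp add: g_def g'_def)
  have contg: "continuous_on UNIV g" using circle_Ck_real_Suc_imp[OF C1g] by simp

  have f_diff: "f (circle_of s) = f (circle_of t) + circle_of (L * (\<phi> s - \<phi> t))" for s t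
  proof -
    have "circle_of (L * \<phi> s) = circle_of (L * \<phi> t) + circle_of (L * (\<phi> s - \<phi> t))"
      by (simp add: algebra_simps flip: circle_of_add)
    then show ?thesis by (simp add: f circle_family_def \<phi>_def add_ac)
  qed
  \<comment> \<open>Since \<open>x\<^sub>0\<close> is fixed on the circle, there is a lift that fixes it on the line.\<close>
  define G where "G t = x0 + L * (\<phi> t - \<phi> x0)" for t
  have lift: "f (circle_of t) = circle_of (G t)" for t
    using f_diff[of t x0] fixed by (simp add: G_def circle_of_add)
  have G': "(G has_real_derivative L * g (circle_of t)) (at t)" for t
    unfolding G_def by (auto intro!: derivative_eq_intros d1)
  have has_f': "has_circle_deriv f (L * g p) p" for p
    using has_circle_deriv_lift[of f, OF lift G'] circle_of_surj by metis
  then have f': "circle_deriv f = (\<lambda>p. L * g p)" using circle_deriv_eq by blast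
  have has_f'': "has_circle_deriv_real (\<lambda>p. L * g p) (L * g' p) p" for p
  proof -
    obtain t where "p = circle_of t" using circle_of_surj by blast
    then show ?thesis
      by (auto simp: has_circle_deriv_real_circle_of_iff intro!: DERIV_cmult d2)
  qed
  then have f'': "circle_deriv_real (\<lambda>p. L * g p) = (\<lambda>p. L * g' p)"
    using circle_deriv_real_eq by blast
  have C2f: "circle_C2 f"
    using has_f' has_f'' contg'
    by (auto simp: circle_C2_def f' f'' intro!: continuous_intros)
  have crit_f: "circle_crit f = {p. g p = 0}" using L by (simp add: circle_crit_def f')
  have chain: "\<bar>circle_deriv (f ^^ n) p\<bar> = (\<Prod>k<n. L * \<bar>g ((f ^^ k) p)\<bar>)" for n p
    using L by (simp add: circle_deriv_funpow[of f, OF lift G'] f' abs_prod abs_mult)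

  define V where "V = {p. \<bar>g p\<bar> < \<eta>}"
  have outside: "(L * \<eta>) ^ n \<le> \<bar>circle_deriv (f ^^ n) p\<bar>" if "\<forall>k<n. (f ^^ k) p \<notin> V" for n p
  proof -
    have "(\<Prod>k<n. L * \<eta>) \<le> (\<Prod>k<n. L * \<bar>g ((f ^^ k) p)\<bar>)"
      using that L pos(1) by (intro prod_mono) (auto simp: V_def not_less)
    then show ?thesis by (simp add: chain)
  qed
  have A: "exp (1 * real n) \<le> \<bar>circle_deriv (f ^^ n) p\<bar>" if "\<forall>k<n. (f ^^ k) p \<notin> V" for n p
  proof -
    have "exp (1 * real n) = exp 1 ^ n" by (simp flip: exp_of_nat_mult)
    also have "\<dots> \<le> (L * \<eta>) ^ n" using large(1) by (intro power_mono) auto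
    also note outside[OF that]
    finally show ?thesis .
  qed
  have "open V"
  proof -
    have "open ((\<lambda>p. \<bar>g p\<bar>) -` {..<\<eta>})"
      by (intro open_vimage open_lessThan continuous_intros contg)
    then show ?thesis by (simp add: V_def vimage_def)
  qed
  then have nbhd: "circle_crit f \<subseteq> interior V"
    using pos(1) by (auto simp: interior_open crit_f V_def)
  have x0V: "circle_of x0 \<notin> V" using away[of x0] pos by (simp add: V_def)
  have "(f ^^ n) (circle_of x0) = circle_of x0" for n by (induction n) (simp_all add: fixed)
  then have crit_orbit: "(f ^^ n) c \<notin> V" if "c \<in> circle_crit f" "0 < n" for c n
    using that crit x0V by (cases n) (auto simp: crit_f funpow_Suc_right simp del: funpow.simps)
  have nondeg: "circle_deriv_real (circle_deriv f) p \<noteq> 0" if "p \<in> V" for p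
    using that low[of p] pos L by (auto simp: f' f'' V_def)

  have recover: "\<exists>p0>0. (\<forall>j. 1 \<le> j \<and> j < p0 \<longrightarrow> (f ^^ j) p \<notin> V) \<and>
      exp (1/3 * real p0) \<le> \<bar>circle_deriv (f ^^ p0) p\<bar>"
    if "p \<in> V - circle_crit f" for p
  proof -
    obtain s where s: "p = circle_of s" using circle_of_surj by blast
    have h: "0 < \<bar>g p\<bar>" "\<bar>g p\<bar> < \<mu> / 2" using that pos by (auto simp: crit_f V_def)
    obtain c where c: "g (circle_of c) = 0" "\<bar>\<phi> s - \<phi> c\<bar> \<le> 4 * B / \<mu>\<^sup>2 * (g p)\<^sup>2"
      using critical_point_near_small_derivative[OF d1 d2 low up(2)] h(2) s by blast
    \<comment> \<open>The lift of \<open>f p\<close> that lies close to \<open>x\<^sub>0\<close> itself rather than to a translate of it.\<close>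
    define y0 where "y0 = x0 + L * (\<phi> s - \<phi> c)"
    have y0: "f p = circle_of y0"
      using f_diff[of s c] crit[OF c(1)] by (simp add: s y0_def circle_of_add)
    define y where "y j = (G ^^ j) y0" for j
    have orbit: "(f ^^ Suc j) p = circle_of (y j)" for j
      by (simp add: funpow_Suc_right y0 y_def funpow_lift[of f, OF lift] del: funpow.simps)
    have step: "\<bar>y (Suc j) - x0\<bar> \<le> L * M * \<bar>y j - x0\<bar>" for j
    proof -
      have "\<bar>\<phi> (y j) - \<phi> x0\<bar> \<le> M * \<bar>y j - x0\<bar>"
        by (rule DERIV_bounded_imp_Lipschitz[OF d1 up(1)])
      then have "L * \<bar>\<phi> (y j) - \<phi> x0\<bar> \<le> L * (M * \<bar>y j - x0\<bar>)"
        using L by (intro mult_left_mono) auto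
      then show ?thesis using L by (simp add: y_def G_def abs_mult mult.assoc)
    qed
    have start: "\<bar>y 0 - x0\<bar> \<le> L * (4 * B / \<mu>\<^sup>2 * \<bar>g p\<bar>\<^sup>2)"
      using mult_left_mono[OF c(2), of L] L by (simp add: y_def y0_def abs_mult)
    have K: "0 < 4 * B / \<mu>\<^sup>2" using pos by simp
    obtain q where q: "\<forall>j<q. \<bar>y j - x0\<bar> \<le> \<delta>"
        "exp (1/3 * real (Suc q)) \<le> L * \<bar>g p\<bar> * (L * \<eta>) ^ q"
      using recovery_time[OF L h(1) pos(1,2) K step start large] by blast
    have out: "(f ^^ Suc j) p \<notin> V" if "j < q" for j
      using q(1) away that unfolding orbit by (auto simp: V_def not_less)
    have "(L * \<eta>) ^ q \<le> (\<Prod>k<q. L * \<bar>g ((f ^^ Suc k) p)\<bar>)"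
    proof -
      have "(\<Prod>k<q. L * \<eta>) \<le> (\<Prod>k<q. L * \<bar>g ((f ^^ Suc k) p)\<bar>)"
        using out L pos(1) by (intro prod_mono) (auto simp: V_def not_less)
      then show ?thesis by simp
    qed
    then have "L * \<bar>g p\<bar> * (L * \<eta>) ^ q \<le> L * \<bar>g p\<bar> * (\<Prod>k<q. L * \<bar>g ((f ^^ Suc k) p)\<bar>)"
      using L by (intro mult_left_mono) auto
    also have "\<dots> = \<bar>circle_deriv (f ^^ Suc q) p\<bar>"
      unfolding chain by (subst prod.lessThan_Suc_shift) simp
    finally have "exp (1/3 * real (Suc q)) \<le> \<bar>circle_deriv (f ^^ Suc q) p\<bar>"
      using q(2) by linarith
    moreover have "(f ^^ j) p \<notin> V" if "1 \<le> j \<and> j < Suc q" for j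
      using that out[of "j - 1"] by (cases j) auto
    ultimately show ?thesis by blast
  qed

  show ?thesis
    unfolding Misiurewicz_def mem_Collect_eq
  proof (intro conjI exI[of _ V] exI[of _ "1::real"] exI[of _ "1::nat"])
    show "\<forall>p\<in>V - circle_crit f. \<exists>p0>0. (\<forall>j. 1 \<le> j \<and> j < p0 \<longrightarrow> (f ^^ j) p \<notin> V) \<and>
        inverse 1 * exp (1 / 3 * 1 * real p0) \<le> \<bar>circle_deriv (f ^^ p0) p\<bar>"
      using recover by simp
    show "\<forall>n\<ge>1. \<forall>x. (\<forall>k<n. (f ^^ k) x \<notin> V) \<longrightarrow> exp (1 * real n) \<le> \<bar>circle_deriv (f ^^ n) x\<bar>"
      using A by blast
    show "\<forall>n>0. \<forall>x. (\<forall>k<n. (f ^^ k) x \<notin> V) \<and> (f ^^ n) x \<in> V \<longrightarrow>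
        1 * exp (1 * real n) \<le> \<bar>circle_deriv (f ^^ n) x\<bar>"
      using A by simp
  qed (use C2f nbhd crit_orbit nondeg in auto)
qed

section \<open>Choice of the parameters\<close>

lemma multiple_in_interval:
  fixes u v w :: real
  assumes "0 < w" "u + w \<le> v"
  shows "\<exists>k::int. u \<le> w * of_int k \<and> w * of_int k \<le> v"
proof -
  have "w * (u / w) \<le> w * of_int \<lceil>u / w\<rceil>" "w * of_int \<lceil>u / w\<rceil> \<le> w * (u / w + 1)"
    using assms(1) by (intro mult_left_mono; linarith)+
  then have "u \<le> w * of_int \<lceil>u / w\<rceil>" "w * of_int \<lceil>u / w\<rceil> \<le> u + w"
    using assms(1) by (simp_all add: distrib_left)
  then show ?thesis using assms(2) by (intro exI[of _ "\<lceil>u / w\<rceil>"]) linarith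
qed

text \<open>On an interval with \<open>\<bar>\<phi>'\<bar> \<ge> \<eta>\<close> and length \<open>2 \<delta>\<close> the function \<open>L \<phi>\<close> varies by at least
  \<open>2 L \<eta> \<delta> \<ge> 2 \<pi>\<close>, and hence takes every value modulo \<open>2 \<pi>\<close>.\<close>

lemma value_modulo_period_attained:
  fixes \<phi> :: "real \<Rightarrow> real"
  assumes d: "\<And>t. (\<phi> has_real_derivative \<phi>' t) (at t)"
    and ge: "\<And>t. \<bar>t - b\<bar> \<le> \<delta> \<Longrightarrow> \<eta> \<le> \<bar>\<phi>' t\<bar>"
    and pos: "0 < \<delta>" "0 < L" and large: "pi \<le> L * \<eta> * \<delta>"
  shows "\<exists>x. \<bar>x - b\<bar> \<le> \<delta> \<and> (\<exists>k::int. L * (\<phi> x - w) = 2 * pi * of_int k)"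
proof -
  define u where "u t = L * (\<phi> t - w)" for t
  have cont: "continuous_on {b-\<delta>..b+\<delta>} u" unfolding u_def
    by (intro continuous_intros continuous_at_imp_continuous_on ballI DERIV_isCont[OF d])
  obtain z where z: "b-\<delta> < z" "z < b+\<delta>" "\<phi> (b+\<delta>) - \<phi> (b-\<delta>) = 2 * \<delta> * \<phi>' z"
    using MVT2[of "b-\<delta>" "b+\<delta>" \<phi> \<phi>'] d pos by auto
  have "2 * pi \<le> L * (2 * \<delta> * \<eta>)" using large by (simp add: mult_ac)
  also have "\<dots> \<le> L * (2 * \<delta> * \<bar>\<phi>' z\<bar>)"
    using ge[of z] z pos by (intro mult_left_mono) auto
  also have "\<dots> = \<bar>L * (\<phi> (b+\<delta>) - \<phi> (b-\<delta>))\<bar>" using pos by (simp add: z(3) abs_mult)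
  also have "\<dots> = \<bar>u (b+\<delta>) - u (b-\<delta>)\<bar>" by (simp add: u_def algebra_simps)
  finally have gap: "2 * pi \<le> \<bar>u (b+\<delta>) - u (b-\<delta>)\<bar>" .
  have hit: "\<exists>x. \<bar>x - b\<bar> \<le> \<delta> \<and> u x = v"
    if v: "u (b-\<delta>) \<le> v \<and> v \<le> u (b+\<delta>) \<or> u (b+\<delta>) \<le> v \<and> v \<le> u (b-\<delta>)" for v
  proof -
    obtain x where "b-\<delta> \<le> x" "x \<le> b+\<delta>" "u x = v"
      using v IVT'[of u "b-\<delta>" v "b+\<delta>"] IVT2'[of u "b+\<delta>" v "b-\<delta>"] cont pos by auto
    then show ?thesis by (intro exI[of _ x]) (simp add: abs_le_iff)
  qed
  have "u (b-\<delta>) + 2 * pi \<le> u (b+\<delta>) \<or> u (b+\<delta>) + 2 * pi \<le> u (b-\<delta>)"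
    using gap by linarith
  then obtain k :: int where "u (b-\<delta>) \<le> 2 * pi * of_int k \<and> 2 * pi * of_int k \<le> u (b+\<delta>) \<or>
      u (b+\<delta>) \<le> 2 * pi * of_int k \<and> 2 * pi * of_int k \<le> u (b-\<delta>)"
    using multiple_in_interval[of "2 * pi"] pi_gt_zero by (meson mult_pos_pos zero_less_numeral)
  from hit[OF this] show ?thesis unfolding u_def by blast
qed

lemma continuous_on_circle_bounded:
  fixes g :: "circle \<Rightarrow> real"
  assumes "continuous_on UNIV g"
  shows "\<exists>M>0. \<forall>p. \<bar>g p\<bar> \<le> M"
proof -
  have "bounded (range g)"
    by (intro compact_imp_bounded compact_continuous_image assms compact_circle)
  then show ?thesis by (auto simp: bounded_pos)
qed

theorem theorem3p4:
  fixes Phi :: "circle \<Rightarrow> real" and c1 c2 zeta :: circle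
  assumes "circle_Ck_real 3 Phi"
    and "{\<theta>. circle_deriv_real Phi \<theta> = 0} = {c1, c2}"
    and "circle_deriv_real (circle_deriv_real Phi) c1 \<noteq> 0"
    and "circle_deriv_real (circle_deriv_real Phi) c2 \<noteq> 0"
    and "Phi c1 \<noteq> Phi c2"
  shows "\<exists>L0>0. \<forall>L\<ge>L0.
           \<exists>Ls\<in>{L .. L + 2 * pi / \<bar>Phi c2 - Phi c1\<bar>}. \<exists>as\<in>{0..<2 * pi}.
             circle_family zeta Phi (circle_of as) Ls \<in> Misiurewicz"
proof -
  define g where "g = circle_deriv_real Phi"
  define g' where "g' = circle_deriv_real g"
  define \<phi> where "\<phi> t = Phi (circle_of t)" for t
  have C2: "circle_Ck_real 2 Phi"
    by (rule circle_Ck_real_Suc_imp) (use assms(1) in \<open>simp add: numeral_3_eq_3 numeral_2_eq_2\<close>)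
  then have exD: "\<forall>p. \<exists>D. has_circle_deriv_real Phi D p" and contg': "continuous_on UNIV g'"
    and C1g: "circle_Ck_real (Suc 0) g"
    by (simp_all add: numeral_2_eq_2 g_def g'_def)
  have contg: "continuous_on UNIV g" using circle_Ck_real_Suc_imp[OF C1g] by simp
  have d1: "(\<phi> has_real_derivative g (circle_of t)) (at t)" for t
    unfolding \<phi>_def g_def by (rule DERIV_circle_of[OF exD])
  have crit: "g p = 0 \<longleftrightarrow> p = c1 \<or> p = c2" for p using assms(2) by (auto simp: g_def)

  obtain M where M: "0 < M" "\<And>p. \<bar>g p\<bar> \<le> M" using continuous_on_circle_bounded[OF contg] by blast
  obtain B where B: "0 < B" "\<And>p. \<bar>g' p\<bar> \<le> B" using continuous_on_circle_bounded[OF contg'] by blast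
  have "continuous_on UNIV (\<lambda>p. \<bar>g p\<bar> + \<bar>g' p\<bar>)" by (intro continuous_intros contg contg')
  then obtain p0 where p0: "\<And>p. \<bar>g p0\<bar> + \<bar>g' p0\<bar> \<le> \<bar>g p\<bar> + \<bar>g' p\<bar>"
    using continuous_attains_inf[OF compact_circle] by auto
  define \<mu> where "\<mu> = \<bar>g p0\<bar> + \<bar>g' p0\<bar>"
  have mu: "0 < \<mu>" using crit[of p0] assms(3,4) by (auto simp: \<mu>_def g_def g'_def)

  have "\<exists>b. g (circle_of b) \<noteq> 0"
  proof (rule ccontr)
    assume "\<nexists>b. g (circle_of b) \<noteq> 0"
    then have "(\<phi> has_real_derivative 0) (at t)" for t using d1[of t] by simp
    then have "\<phi> s = \<phi> t" for s t by (rule DERIV_isconst_all[OF allI])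
    then show False using assms(5) circle_of_surj \<phi>_def by metis
  qed
  then obtain b where b: "g (circle_of b) \<noteq> 0" by blast
  define \<eta> where "\<eta> = min (\<mu> / 2) (\<bar>g (circle_of b)\<bar> / 2)"
  have eta: "0 < \<eta>" "2 * \<eta> \<le> \<mu>" "\<eta> < \<bar>g (circle_of b)\<bar>" using mu b by (auto simp: \<eta>_def)
  have "isCont (\<lambda>t. \<bar>g (circle_of t)\<bar>) b"
    using contg by (auto simp: continuous_on_circle_iff continuous_on_eq_continuous_at
        intro!: continuous_intros)
  then have "\<forall>\<^sub>F t in at b. \<eta> < \<bar>g (circle_of t)\<bar>"
    using eta(3) unfolding isCont_def by (rule order_tendstoD)
  then obtain e where e: "0 < e" "\<And>t. t \<noteq> b \<Longrightarrow> dist t b < e \<Longrightarrow> \<eta> < \<bar>g (circle_of t)\<bar>"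
    by (auto simp: eventually_at)
  \<comment> \<open>The fixed point will be within \<open>\<delta>\<close> of \<open>b\<close>, and its own \<open>\<delta>\<close>-ball must stay
    where \<open>\<bar>g\<bar> \<ge> \<eta>\<close>.\<close>
  define \<delta> where "\<delta> = e / 3"
  have delta: "0 < \<delta>" using e(1) by (simp add: \<delta>_def)
  have away: "\<eta> \<le> \<bar>g (circle_of t)\<bar>" if "\<bar>t - b\<bar> \<le> 2 * \<delta>" for t
    using e(2)[of t] eta(3) that e(1) by (cases "t = b") (auto simp: \<delta>_def dist_real_def)

  define K where "K = 4 * B / \<mu>\<^sup>2"
  define L0 where "L0 = Max {exp 1 / \<eta>, exp 1 * M / \<eta>\<^sup>2, exp 1 * K / \<delta>, pi / (\<eta> * \<delta>)}"
  have L0: "exp 1 / \<eta> \<le> L0" "exp 1 * M / \<eta>\<^sup>2 \<le> L0" "exp 1 * K / \<delta> \<le> L0" "pi / (\<eta> * \<delta>) \<le> L0"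
    by (simp_all add: L0_def)
  have "0 < exp 1 / \<eta>" using eta by simp
  then have L0pos: "0 < L0" using L0(1) by linarith
  have "\<exists>Ls\<in>{L .. L + 2 * pi / \<bar>Phi c2 - Phi c1\<bar>}. \<exists>as\<in>{0..<2 * pi}.
             circle_family zeta Phi (circle_of as) Ls \<in> Misiurewicz" if "L0 \<le> L" for L
  proof -
    define w where "w = 2 * pi / \<bar>Phi c2 - Phi c1\<bar>"
    have w: "0 < w" "w * \<bar>Phi c2 - Phi c1\<bar> = 2 * pi" using assms(5) by (simp_all add: w_def)
    obtain k :: int where k: "L \<le> w * of_int k" "w * of_int k \<le> L + w"
      using multiple_in_interval[OF w(1) order_refl] by blast
    define Ls where "Ls = w * of_int k"
    have Ls: "L \<le> Ls" "Ls \<le> L + w" "0 < Ls" using k L0pos that by (auto simp: Ls_def)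
    have "Ls * \<bar>Phi c2 - Phi c1\<bar> = 2 * pi * of_int k"
      using w(2) by (simp add: Ls_def mult_ac)
    then have "\<exists>m::int. Ls * Phi c2 - Ls * Phi c1 = 2 * pi * of_int m"
      by (intro exI[of _ "if Phi c1 \<le> Phi c2 then k else -k"]) 
        (auto simp: algebra_simps abs_if split: if_splits)
    then have same: "circle_of (Ls * Phi c2) = circle_of (Ls * Phi c1)"
      by (simp add: circle_of_eq_iff)
    have le: "L0 \<le> Ls" using that Ls by simp
    have large: "exp 1 \<le> Ls * \<eta>" "exp 1 * M \<le> Ls * \<eta>\<^sup>2" "exp 1 * K \<le> Ls * \<delta>" "pi \<le> Ls * \<eta> * \<delta>"
      using order_trans[OF L0(1) le] order_trans[OF L0(2) le] order_trans[OF L0(3) le]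
        order_trans[OF L0(4) le] eta delta by (simp_all add: pos_divide_le_eq mult.assoc)
    obtain x0 where x0: "\<bar>x0 - b\<bar> \<le> \<delta>" "\<exists>k::int. Ls * (\<phi> x0 - Phi c1) = 2 * pi * of_int k"
      using value_modulo_period_attained[OF d1, of b \<delta> \<eta> Ls "Phi c1"] away delta Ls(3) large(4)
      by auto
    have x0c: "circle_of (Ls * Phi (circle_of x0)) = circle_of (Ls * Phi c1)"
      using x0(2) by (simp add: circle_of_eq_iff \<phi>_def algebra_simps)
    obtain \<alpha> where \<alpha>: "\<alpha> \<in> {0..<2*pi}"
        "circle_of x0 - zeta - circle_of (Ls * Phi c1) = circle_of \<alpha>"
      using circle_of_representative by blast
    define f where "f = circle_family zeta Phi (circle_of \<alpha>) Ls"
    have hit: "f p = circle_of x0" if "circle_of (Ls * Phi p) = circle_of (Ls * Phi c1)" for p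
      by (simp add: f_def circle_family_def that flip: \<alpha>(2))
    have "f \<in> Misiurewicz"
    proof (rule Misiurewicz_if_critical_values_fixed[OF C2 f_def Ls(3)])
      show "f p = circle_of x0" if "circle_deriv_real Phi p = 0" for p
        using that crit[of p] hit same by (auto simp: g_def)
      show "f (circle_of x0) = circle_of x0" by (rule hit[OF x0c])
      show "\<eta> \<le> \<bar>circle_deriv_real Phi (circle_of t)\<bar>" if "\<bar>t - x0\<bar> \<le> \<delta>" for t
        using away[of t] that x0(1) by (simp add: g_def)
      show "\<mu> \<le> \<bar>circle_deriv_real Phi p\<bar> + \<bar>circle_deriv_real (circle_deriv_real Phi) p\<bar>" for p
        using p0[of p] by (simp add: \<mu>_def g_def g'_def)
    qed (use M B eta delta large in \<open>auto simp: g_def g'_def K_def\<close>)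
    moreover have "Ls \<in> {L .. L + w}" using Ls by simp
    ultimately show ?thesis using \<alpha>(1) unfolding f_def w_def by blast
  qed
  then show ?thesis using L0pos by blast
qed

end
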